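(* Let $U$ and $V$ consist of $n$ i.i.d. random points each, sampled independently from probability measures $\mu$ (supply) and $\nu$ (demand) on the network $\mathcal L$, and let $\mathbf c^{\mathrm{int}}$ be the optimal solution of $$\min_{\mathbf c\in\mathbb Z^{|\mathcal E|}}\ \sum_{e\in\mathcal E}\Psi_e(c_e;S_e)\quad\text{s.t.}\quad\mathbf I\mathbf c=\mathbf I^+\mathbf s .$$ When $\mu=\nu$, for every $e\in\mathcal E$ the random variable $\mathbf c^{\mathrm{int}}_e$ has a centered, symmetric, and sub-Gaussian distribution with an $O(n)$ variance proxy.
   Context: $(\mathcal V,\mathcal E)$ is an undirected network. Each edge $e\in\mathcal E$ has length $l_e\ge 0$ and end nodes $v_e^-,v_e^+\in\mathcal V$ (an arbitrary orientation from $v_e^-$ to $v_e^+$ is fixed). A location on $e$ is recorded as $(e,x)$, $x\in[0,l_e]$, where $x$ is the distance from $v_e^-$ along $e$. Put $\mathcal L_e(x)=\{(e,y):y\in[0,x]\}$ and $\mathcal L=\bigcup_{e}\mathcal L_e(l_e)$. $\mu,\nu$ are probability measures on a $\sigma$-algebra $\mathcal F$ on $\mathcal L$. The network and $\mu,\nu$ are fixed while $n$ varies. The imbalance profile of edge $e$ is $S_e(x)=|U\cap\mathcal L_e(x)|-|V\cap\mathcal L_e(x)|$ for $x\in[0,l_e]$, and $\mathbf s=(S_e(l_e))_{e\in\mathcal E}$. For a profile $\xi_e:[0,l_e]\to\mathbb R$ and $c\in\mathbb R$, $\Psi_e(c;\xi_e)=\int_0^{l_e}|\xi_e(x)-c|\,dx$.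 $\mathbf I^+$ (resp. $\mathbf I^-$) is the $\mathcal V\times\mathcal E$ matrix whose $(v,e)$ entry is $1$ if $v_e^+=v$ (resp. $v_e^-=v$) and $0$ otherwise; $\mathbf I=\mathbf I^+-\mathbf I^-$. Sub-Gaussian with $O(n)$ variance proxy means: there is a constant $C>0$ independent of $n$ such that $\mathbb P(|\mathbf c^{\mathrm{int}}_e|\ge t)\le 2\exp(-t^2/(Cn))$ for every $t\ge0$.
   Formalization: "The optimal solution" need not be unique; c^int is taken as a measurable choice of an optimum depending only on the profiles, negated when supply and demand swap on instances with ties, and cycles of zero total length are excluded; under a.s. uniqueness nothing is lost. *)

theory Defs
  imports "HOL-Probability.Probability"
begin

text \<open>
  A finite network is given by an edge type \<open>'e\<close>, a node type \<open>'v\<close>, edge lengths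
  \<open>len :: 'e \<Rightarrow> real\<close> and the end nodes \<open>v_minus, v_plus :: 'e \<Rightarrow> 'v\<close> of every edge
  (parallel edges and loops are allowed). A location is a pair \<open>(e, x)\<close>, where \<open>x\<close> is the
  distance from \<open>v_minus e\<close> along \<open>e\<close>.
\<close>

definition segment :: "'e \<Rightarrow> real \<Rightarrow> ('e \<times> real) set" where
  "segment e x = {e} \<times> {0..x}"

definition locations :: "('e \<Rightarrow> real) \<Rightarrow> ('e \<times> real) set" where
  "locations len = (\<Union>e. segment e (len e))"

text \<open>
  The points are indexed families, so coinciding points (possible if the measures have atoms)
  are counted with multiplicity.
\<close>

definition imbalance ::
  "nat \<Rightarrow> (nat \<Rightarrow> 'e \<times> real) \<Rightarrow> (nat \<Rightarrow> 'e \<times> real) \<Rightarrow> 'e \<Rightarrow> real \<Rightarrow> int" where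
  "imbalance n u v e x =
     int (card {i \<in> {..<n}. u i \<in> segment e x}) - int (card {i \<in> {..<n}. v i \<in> segment e x})"

definition Psi :: "('e \<Rightarrow> real) \<Rightarrow> 'e \<Rightarrow> real \<Rightarrow> (real \<Rightarrow> real) \<Rightarrow> real" where
  "Psi len e c \<xi> = integral {0..len e} (\<lambda>x. \<bar>\<xi> x - c\<bar>)"

definition endpoint_matrix :: "('e::finite \<Rightarrow> 'v::finite) \<Rightarrow> int ^ 'e ^ 'v" where
  "endpoint_matrix w = (\<chi> v e. if w e = v then 1 else 0)"

definition incidence :: "('e::finite \<Rightarrow> 'v::finite) \<Rightarrow> ('e \<Rightarrow> 'v) \<Rightarrow> int ^ 'e ^ 'v" where
  "incidence v_minus v_plus = endpoint_matrix v_plus - endpoint_matrix v_minus"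

definition total_cost :: "('e::finite \<Rightarrow> real) \<Rightarrow> ('e \<Rightarrow> real \<Rightarrow> int) \<Rightarrow> int ^ 'e \<Rightarrow> real" where
  "total_cost len S c =
     (\<Sum>e\<in>UNIV. Psi len e (real_of_int (c $ e)) (\<lambda>x. real_of_int (S e x)))"

definition feasible ::
  "('e::finite \<Rightarrow> real) \<Rightarrow> ('e \<Rightarrow> 'v::finite) \<Rightarrow> ('e \<Rightarrow> 'v) \<Rightarrow> ('e \<Rightarrow> real \<Rightarrow> int) \<Rightarrow>
   int ^ 'e \<Rightarrow> bool" where
  "feasible len v_minus v_plus S c \<longleftrightarrow>
     incidence v_minus v_plus *v c = endpoint_matrix v_plus *v (\<chi> e. S e (len e))"

definition optimal_solution ::
  "('e::finite \<Rightarrow> real) \<Rightarrow> ('e \<Rightarrow> 'v::finite) \<Rightarrow> ('e \<Rightarrow> 'v) \<Rightarrow> ('e \<Rightarrow> real \<Rightarrow> int) \<Rightarrow>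
   int ^ 'e \<Rightarrow> bool" where
  "optimal_solution len v_minus v_plus S =
     is_arg_min (total_cost len S) (feasible len v_minus v_plus S)"

text \<open>
  If the edges of length 0 contain a cycle, circulating flow around it changes neither the cost
  nor feasibility, so the set of optimal solutions is empty or unbounded and no optimal solution
  is ever unique. The next condition excludes this; it holds trivially if all lengths are positive.
\<close>

definition no_zero_length_cycle ::
  "('e::finite \<Rightarrow> real) \<Rightarrow> ('e \<Rightarrow> 'v::finite) \<Rightarrow> ('e \<Rightarrow> 'v) \<Rightarrow> bool" where
  "no_zero_length_cycle len v_minus v_plus \<longleftrightarrow>
     (\<forall>d. incidence v_minus v_plus *v d = 0 \<and> (\<forall>e. d $ e \<noteq> 0 \<longrightarrow> len e = 0) \<longrightarrow> d = 0)"

text \<open>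
  The integer program may have several optimal solutions with positive probability (for instance
  on two parallel edges of equal length), and an arbitrary choice among them need not have a
  symmetric law. A tie-breaking convention \<open>opt\<close> is called sign-neutral if, on instances with more
  than one optimal solution, interchanging supply and demand (which replaces the imbalance profile
  by its negative) negates the chosen solution. Nothing is required on instances with a unique
  optimal solution.
\<close>

definition sign_neutral_ties ::
  "('e::finite \<Rightarrow> real) \<Rightarrow> ('e \<Rightarrow> 'v::finite) \<Rightarrow> ('e \<Rightarrow> 'v) \<Rightarrow>
   (('e \<Rightarrow> real \<Rightarrow> int) \<Rightarrow> int ^ 'e) \<Rightarrow> bool" where
  "sign_neutral_ties len v_minus v_plus opt \<longleftrightarrow>
     (\<forall>n. \<forall>u \<in> {..<n} \<rightarrow> locations len. \<forall>v \<in> {..<n} \<rightarrow> locations len.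
        (\<exists>c c'. c \<noteq> c' \<and>
           optimal_solution len v_minus v_plus (imbalance n u v) c \<and>
           optimal_solution len v_minus v_plus (imbalance n u v) c') \<longrightarrow>
        opt (imbalance n v u) = - opt (imbalance n u v))"

end

theory Submission
  imports Defs
begin

text \<open>
  Interchanging supply and demand preserves the joint law when \<open>\<mu> = \<nu>\<close> and turns the profile \<open>S\<close> into
  \<open>-S\<close>, hence an optimal \<open>c\<close> into \<open>-c\<close>; this gives symmetry and, by boundedness, centering.

  For the tail, an optimal \<open>c\<close> is bounded pointwise by a weighted \<open>L\<^sup>1\<close> size of the profile:
  if \<open>\<bar>c\<^sub>e\<bar>\<close> were larger, then either \<open>e\<close> lies on a directed cycle all of whose edges carry much flow,
  and cancelling part of that flow lowers the cost, or a cut separates the end nodes of \<open>e\<close>, through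
  which the conservation constraint admits only little flow. Since this size is an average of
  variables \<open>\<bar>S\<^sub>f(x)\<bar>\<close>, each of them a sum of \<open>n\<close> independent symmetric steps, Jensen's inequality
  transfers the moment generating function bound for a fixed \<open>x\<close> to the average. No bound on
  \<open>sup\<^sub>x \<bar>S\<^sub>f(x)\<bar>\<close> is needed.
\<close>

section \<open>Optimal flows are bounded by the imbalance\<close>

text \<open>Nodes are explored from \<open>hd e\<close> along edges of \<open>P\<close>. If the
  exploration meets \<open>tl e\<close>, the set \<open>D\<close> is a path from \<open>hd e\<close>
  to \<open>tl e\<close>, recorded by its node balance, and \<open>e\<close> closes it to a
  circulation. Otherwise the explored set \<open>R\<close> is a cut that no edge of \<open>P\<close>
  leaves.\<close>

lemma cycle_or_cut:
  fixes hd tl :: "'e::finite \<Rightarrow> 'v::finite" and P :: "'e set" and e :: 'e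
  shows "(\<exists>D. D \<subseteq> P \<and> e \<notin> D \<and>
             (\<forall>v. (\<Sum>f\<in>D. of_bool (hd f = v) - of_bool (tl f = v) :: int) = of_bool (tl e = v) - of_bool (hd e = v)))
       \<or> (\<exists>R. hd e \<in> R \<and> tl e \<notin> R \<and> (\<forall>f\<in>P. tl f \<in> R \<longrightarrow> hd f \<in> R))"
proof -
  txt \<open>Take a maximal set of nodes that can be reached inside it. Representing paths by sets of edges
    makes every edge be used at most once.\<close>
  define path where "path R w D \<longleftrightarrow> D \<subseteq> P \<and> e \<notin> D \<and> (\<forall>f\<in>D. hd f \<in> R \<and> tl f \<in> R) \<and>
      (\<forall>v. (\<Sum>f\<in>D. of_bool (hd f = v) - of_bool (tl f = v) :: int) = of_bool (w = v) - of_bool (hd e = v))"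
    for R w D
  define Q where "Q = {R. hd e \<in> R \<and> (\<forall>w\<in>R. \<exists>D. path R w D)}"
  have "path {hd e} (hd e) {}"
    by (auto simp: path_def)
  hence "{hd e} \<in> Q"
    by (auto simp: Q_def)
  then obtain R where R: "R \<in> Q" and max: "\<And>R'. R' \<in> Q \<Longrightarrow> R \<subseteq> R' \<Longrightarrow> R' = R"
    using finite_has_maximal2[of Q "{hd e}"] by (metis finite)
  show ?thesis
  proof (cases "\<forall>f\<in>P. tl f \<in> R \<longrightarrow> hd f \<in> R")
    case True
    show ?thesis
    proof (cases "tl e \<in> R")
      case True
      then obtain D where "path R (tl e) D"
        using R by (auto simp: Q_def)
      thus ?thesis
        unfolding path_def by blast
    next
      case False
      thus ?thesis
        using \<open>\<forall>f\<in>P. tl f \<in> R \<longrightarrow> hd f \<in> R\<close> R by (auto simp: Q_def)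
    qed
  next
    case False
    then obtain f where f: "f \<in> P" "tl f \<in> R" "hd f \<notin> R"
      by auto
    obtain D0 where D0: "path R (tl f) D0"
      using R f by (auto simp: Q_def)
    \<comment> \<open>Both \<open>e\<close> and the edges of \<open>D0\<close> have their heads
      inside \<open>R\<close>, whereas \<open>f\<close> leaves \<open>R\<close>. This is why
      \<open>path\<close> asks for edges with both ends in \<open>R\<close>.\<close>
    have "f \<noteq> e" "f \<notin> D0"
      using R f D0 by (auto simp: Q_def path_def)
    hence "path (insert (hd f) R) (hd f) (insert f D0)"
      using D0 f by (auto simp: path_def)
    moreover have "path (insert (hd f) R) w D" if "path R w D" for w D
      using that by (auto simp: path_def)
    ultimately have "insert (hd f) R \<in> Q"
      using R by (fastforce simp: Q_def)
    with max[of "insert (hd f) R"] f show ?thesis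
      by auto
  qed
qed

lemma incidence_mult:
  "(incidence v_minus v_plus *v d) $ v =
     (\<Sum>f\<in>UNIV. (of_bool (v_plus f = v) - of_bool (v_minus f = v)) * d $ f)"
  by (simp add: matrix_vector_mult_def incidence_def endpoint_matrix_def of_bool_def)

lemma endpoint_matrix_mult:
  "(endpoint_matrix w *v d) $ v = (\<Sum>f\<in>UNIV. of_bool (w f = v) * d $ f)"
  by (simp add: matrix_vector_mult_def endpoint_matrix_def of_bool_def)

text \<open>An optimal flow cannot carry much around a cycle, since rerouting would be cheaper, nor
  across a cut, by conservation. The right-hand side is exactly what makes both alternatives of
  \<open>cycle_or_cut\<close> contradictory.\<close>

lemma optimal_solution_bound:
  fixes len :: "'e::finite \<Rightarrow> real" and v_minus v_plus :: "'e \<Rightarrow> 'v::finite"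
  assumes len_nonneg: "\<And>e. 0 \<le> len e"
    and no_zero_cycle: "no_zero_length_cycle len v_minus v_plus"
    and opt: "optimal_solution len v_minus v_plus S c"
    and integrable: "\<And>f k. (\<lambda>x. \<bar>real_of_int (S f x) - k\<bar>) integrable_on {0..len f}"
    and "0 < \<delta>" and \<delta>: "\<And>f. 0 < len f \<Longrightarrow> \<delta> \<le> len f"
  shows "\<bar>real_of_int (c $ e)\<bar> \<le>
     (\<Sum>f\<in>UNIV. 2 * CARD('e) / \<delta> * integral {0..len f} (\<lambda>x. \<bar>real_of_int (S f x)\<bar>)
                + \<bar>real_of_int (S f (len f))\<bar>)"
proof (rule ccontr)
  define \<Lambda> where "\<Lambda> f = integral {0..len f} (\<lambda>x. \<bar>real_of_int (S f x)\<bar>)" for f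
  \<comment> \<open>The threshold at which cancelling pays off: more than \<open>\<theta>\<close>
    units, removed from an edge of length at least \<open>\<delta>\<close>, save more than twice the
    total of \<open>\<Lambda>\<close>.\<close>
  define \<theta> where "\<theta> = 2 * (\<Sum>f\<in>UNIV. \<Lambda> f) / \<delta>"
  \<comment> \<open>Every edge is oriented along the flow it carries, so that flow becomes
    \<open>\<bar>c $ f\<bar>\<close> from \<open>tl f\<close> to \<open>hd f\<close>.\<close>
  define hd where "hd f = (if 0 < c $ f then v_plus f else v_minus f)" for f
  define tl where "tl f = (if 0 < c $ f then v_minus f else v_plus f)" for f
  define P where "P = {f. \<theta> < \<bar>real_of_int (c $ f)\<bar>}"
  assume "\<not> ?thesis"
  hence large: "CARD('e) * \<theta> + (\<Sum>f\<in>UNIV. \<bar>real_of_int (S f (len f))\<bar>) < \<bar>real_of_int (c $ e)\<bar>"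
    by (simp add: \<theta>_def \<Lambda>_def sum.distrib sum_distrib_left sum_divide_distrib field_simps)
  have feas: "feasible len v_minus v_plus S c"
    and min: "\<And>c'. feasible len v_minus v_plus S c' \<Longrightarrow> total_cost len S c \<le> total_cost len S c'"
    using opt by (auto simp: optimal_solution_def is_arg_min_def not_less)
  have \<Lambda>_nonneg: "0 \<le> \<Lambda> f" for f
    unfolding \<Lambda>_def using integrable[of f 0] by (intro integral_nonneg) auto
  hence \<theta>_nonneg: "0 \<le> \<theta>"
    using \<open>0 < \<delta>\<close> sum_nonneg[of UNIV \<Lambda>] by (simp add: \<theta>_def)
  have "\<theta> \<le> CARD('e) * \<theta>"
    using \<theta>_nonneg mult_right_mono[of 1 "real CARD('e)" \<theta>] by (simp add: Suc_leI)
  hence "e \<in> P"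
    using large sum_nonneg[of UNIV "\<lambda>f. \<bar>real_of_int (S f (len f))\<bar>"]
    unfolding P_def mem_Collect_eq by (smt (verit) abs_ge_zero)
  from cycle_or_cut[of P e hd tl] show False
  proof (elim disjE exE conjE)
    fix D
    assume D: "D \<subseteq> P" "e \<notin> D"
      "\<forall>v. (\<Sum>f\<in>D. of_bool (hd f = v) - of_bool (tl f = v) :: int) = of_bool (tl e = v) - of_bool (hd e = v)"
    define D' where "D' = insert e D"
    define d :: "int ^ 'e" where "d = (\<chi> f. if f \<in> D' then sgn (c $ f) else 0)"
    \<comment> \<open>Cancelling \<open>k\<close> units along the cycle stays within \<open>\<bar>c\<^sub>f\<bar>\<close>, so it gains \<open>k\<close> times the length,
      up to an error of twice the \<open>L\<^sup>1\<close> norm of the profile.\<close>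
    define k where "k = \<lfloor>\<theta>\<rfloor> + 1"
    define c' where "c' = (\<chi> f. c $ f - k * d $ f)"
    have nz: "c $ f \<noteq> 0" and k_le: "k \<le> \<bar>c $ f\<bar>" if "f \<in> D'" for f
    proof -
      have *: "\<theta> < real_of_int \<bar>c $ f\<bar>"
        using that D \<open>e \<in> P\<close> by (auto simp: D'_def P_def)
      thus "c $ f \<noteq> 0"
        using \<theta>_nonneg by auto
      \<comment> \<open>An integer above \<open>\<theta>\<close> is at least the floor of
        \<open>\<theta>\<close> plus 1.\<close>
      show "k \<le> \<bar>c $ f\<bar>"
        using * unfolding k_def by linarith
    qed
    have circ: "incidence v_minus v_plus *v d = 0"
    proof (rule vec_eq_iff[THEN iffD2], rule)
      fix v
      have "(incidence v_minus v_plus *v d) $ v = (\<Sum>f\<in>D'. (of_bool (v_plus f = v) - of_bool (v_minus f = v)) * sgn (c $ f))"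
        unfolding incidence_mult d_def by (intro sum.mono_neutral_cong_right) auto
      also have "\<dots> = (\<Sum>f\<in>D'. of_bool (hd f = v) - of_bool (tl f = v))"
        using nz by (intro sum.cong) (auto simp: hd_def tl_def sgn_if)
      also have "\<dots> = 0"
        using D by (simp add: D'_def)
      finally show "(incidence v_minus v_plus *v d) $ v = 0 $ v"
        by simp
    qed
    have "d $ e \<noteq> 0"
      using nz[of e] by (auto simp: d_def D'_def sgn_if)
    hence "d \<noteq> 0"
      by auto
    \<comment> \<open>A nonzero circulation cannot live on edges of length 0 alone, so some edge of
      the cycle has length at least \<open>\<delta>\<close> and yields the saving.\<close>
    then obtain f0 where f0: "d $ f0 \<noteq> 0" "len f0 \<noteq> 0"
      using no_zero_cycle circ unfolding no_zero_length_cycle_def by blast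
    hence f0': "f0 \<in> D'" "\<delta> \<le> len f0"
      using len_nonneg[of f0] by (auto simp: d_def intro!: \<delta> split: if_splits)
    have "incidence v_minus v_plus *v c' = incidence v_minus v_plus *v c"
    proof (rule vec_eq_iff[THEN iffD2], rule)
      fix v
      have "(incidence v_minus v_plus *v c') $ v =
        (incidence v_minus v_plus *v c) $ v - k * (incidence v_minus v_plus *v d) $ v"
        unfolding incidence_mult c'_def
        by (simp add: sum_distrib_left sum_subtractf[symmetric] algebra_simps)
      thus "(incidence v_minus v_plus *v c') $ v = (incidence v_minus v_plus *v c) $ v"
        by (simp add: circ)
    qed
    hence "feasible len v_minus v_plus S c'"
      using feas by (simp add: feasible_def)
    hence le: "total_cost len S c \<le> total_cost len S c'"
      by (rule min)
    have shift: "Psi len f (real_of_int (c' $ f)) (\<lambda>x. real_of_int (S f x)) \<le>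
        Psi len f (real_of_int (c $ f)) (\<lambda>x. real_of_int (S f x)) + 2 * \<Lambda> f - of_bool (f \<in> D') * (k * len f)" for f
    proof -
      let ?I = "integral {0..len f}"
      let ?r = "of_bool (f \<in> D') * real_of_int k"
      have k0: "0 \<le> k"
        using \<theta>_nonneg by (simp add: k_def)
      have "\<bar>c' $ f\<bar> = \<bar>c $ f\<bar> - of_bool (f \<in> D') * k"
        using k_le[of f] nz[of f] k0 by (auto simp: c'_def d_def sgn_if)
      hence abs: "\<bar>real_of_int (c' $ f)\<bar> = \<bar>real_of_int (c $ f)\<bar> - ?r"
        by (metis (mono_tags) of_int_abs of_int_diff of_int_mult of_int_of_bool)
      \<comment> \<open>Pointwise, with \<open>r\<close> the amount cancelled: |S - c'| \<le> |S| +
        |c'| = |S| + |c| - r \<le> |S - c| + 2|S| - r.\<close>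
      have "?I (\<lambda>x. \<bar>real_of_int (S f x) - real_of_int (c' $ f)\<bar>) \<le>
          ?I (\<lambda>x. \<bar>real_of_int (S f x) - real_of_int (c $ f)\<bar> + 2 * \<bar>real_of_int (S f x)\<bar> - ?r)"
      proof (rule integral_le)
        show "(\<lambda>x. \<bar>real_of_int (S f x) - real_of_int (c $ f)\<bar> + 2 * \<bar>real_of_int (S f x)\<bar> - ?r) integrable_on {0..len f}"
          using integrable[of f 0]
          by (intro integrable_diff integrable_add integrable integrable_const_ivl integrable_on_mult_right[where c = "2::real"]) auto
      qed (use integrable abs in auto)
      also have "\<dots> = ?I (\<lambda>x. \<bar>real_of_int (S f x) - real_of_int (c $ f)\<bar>) + 2 * \<Lambda> f - ?r * len f"
      proof -
        have "(\<lambda>x. 2 * \<bar>real_of_int (S f x)\<bar>) integrable_on {0..len f}"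
          using integrable[of f 0] by (intro integrable_on_mult_right[where c = "2::real"]) auto
        thus ?thesis
          using integrable[of f "c $ f"] len_nonneg[of f]
          by (simp add: integral_diff integral_add integrable_add \<Lambda>_def integrable_const_ivl)
      qed
      finally show ?thesis
        by (simp add: Psi_def algebra_simps)
    qed
    have "total_cost len S c' \<le> total_cost len S c + 2 * sum \<Lambda> UNIV - k * sum len D'"
    proof -
      have "total_cost len S c' \<le> (\<Sum>f\<in>UNIV. Psi len f (real_of_int (c $ f)) (\<lambda>x. real_of_int (S f x))
          + 2 * \<Lambda> f - of_bool (f \<in> D') * (k * len f))"
        unfolding total_cost_def by (intro sum_mono shift)
      also have "\<dots> = total_cost len S c + 2 * sum \<Lambda> UNIV - (\<Sum>f\<in>UNIV. of_bool (f \<in> D') * (k * len f))"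
        by (simp add: total_cost_def sum.distrib sum_subtractf sum_distrib_left)
      also have "(\<Sum>f\<in>UNIV. of_bool (f \<in> D') * (k * len f)) = k * sum len D'"
        unfolding sum_distrib_left by (intro sum.mono_neutral_cong_right) auto
      finally show ?thesis .
    qed
    moreover have "2 * sum \<Lambda> UNIV < k * sum len D'"
    proof -
      have "\<theta> < real_of_int k"
        unfolding k_def by linarith
      hence "2 * sum \<Lambda> UNIV < k * \<delta>"
        using \<open>0 < \<delta>\<close> by (simp add: \<theta>_def field_simps)
      also have "\<dots> \<le> k * sum len D'"
        using \<open>\<theta> < k\<close> \<theta>_nonneg f0' member_le_sum[of f0 D' len] len_nonneg
        by (intro mult_left_mono) auto
      finally show ?thesis .
    qed
    ultimately show False
      using le by simp
  next
    fix R
    assume R: "hd e \<in> R" "tl e \<notin> R" "\<forall>f\<in>P. tl f \<in> R \<longrightarrow> hd f \<in> R"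
    have swap: "(\<Sum>v\<in>R. \<Sum>f\<in>UNIV. g f v * h f) = (\<Sum>f\<in>UNIV. (\<Sum>v\<in>R. g f v) * h f)"
      for g :: "'e \<Rightarrow> 'v \<Rightarrow> int" and h
      by (subst sum.swap) (simp add: sum_distrib_right)
    have ind: "(\<Sum>v\<in>R. of_bool (w = v)) = (of_bool (w \<in> R) :: int)" for w
      by (simp add: of_bool_def)
    \<comment> \<open>Summing the constraint over the nodes of \<open>R\<close> leaves on the left
      only the edges with exactly one end in \<open>R\<close>.\<close>
    have "(\<Sum>v\<in>R. (incidence v_minus v_plus *v c) $ v) = (\<Sum>v\<in>R. (endpoint_matrix v_plus *v (\<chi> f. S f (len f))) $ v)"
      using feas by (simp add: feasible_def)
    hence "(\<Sum>f\<in>UNIV. (of_bool (v_plus f \<in> R) - of_bool (v_minus f \<in> R)) * c $ f)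
         = (\<Sum>f\<in>UNIV. of_bool (v_plus f \<in> R) * S f (len f))"
      unfolding incidence_mult endpoint_matrix_mult swap sum_subtractf ind by simp
    moreover have "(\<Sum>f\<in>UNIV. (of_bool (v_plus f \<in> R) - of_bool (v_minus f \<in> R)) * c $ f)
         = (\<Sum>f\<in>UNIV. (of_bool (hd f \<in> R) - of_bool (tl f \<in> R)) * \<bar>c $ f\<bar>)"
      by (intro sum.cong) (auto simp: hd_def tl_def)
    ultimately have "(\<Sum>f\<in>UNIV. (of_bool (hd f \<in> R) - of_bool (tl f \<in> R)) * \<bar>c $ f\<bar>)
         = (\<Sum>f\<in>UNIV. of_bool (v_plus f \<in> R) * S f (len f))"
      by simp
    from arg_cong[OF this, of real_of_int]
    have "(\<Sum>f\<in>UNIV. (of_bool (hd f \<in> R) - of_bool (tl f \<in> R)) * \<bar>real_of_int (c $ f)\<bar>)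
         = (\<Sum>f\<in>UNIV. of_bool (v_plus f \<in> R) * real_of_int (S f (len f)))"
      by simp
    also have "\<dots> \<le> (\<Sum>f\<in>UNIV. \<bar>real_of_int (S f (len f))\<bar>)"
      by (intro sum_mono) auto
    finally have upper: "(\<Sum>f\<in>UNIV. (of_bool (hd f \<in> R) - of_bool (tl f \<in> R)) * \<bar>real_of_int (c $ f)\<bar>)
        \<le> (\<Sum>f\<in>UNIV. \<bar>real_of_int (S f (len f))\<bar>)" .
    have small: "\<bar>real_of_int (c $ f)\<bar> \<le> \<theta>" if "tl f \<in> R" "hd f \<notin> R" for f
      using R(3) that unfolding P_def by force
    \<comment> \<open>The edge \<open>e\<close> enters \<open>R\<close> with its full flow. An edge
      leaving \<open>R\<close> is outside \<open>P\<close> and costs at most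
      \<open>\<theta>\<close>; all remaining edges contribute nonnegatively.\<close>
    have "\<bar>real_of_int (c $ e)\<bar> - CARD('e) * \<theta> = (\<Sum>f\<in>UNIV. (if f = e then \<bar>real_of_int (c $ e)\<bar> else 0) - \<theta>)"
      by (simp add: sum_subtractf)
    also have "\<dots> \<le> (\<Sum>f\<in>UNIV. (of_bool (hd f \<in> R) - of_bool (tl f \<in> R)) * \<bar>real_of_int (c $ f)\<bar>)"
      using R \<theta>_nonneg small by (intro sum_mono) (auto simp: P_def)
    finally show False
      using upper large by linarith
  qed
qed

section \<open>Imbalance of random samples\<close>

text \<open>Hoeffding's lemma for a fair sign. It is applied at \<open>2 * \<bar>l\<bar>\<close>,
  which is nonnegative, and the absolute value disappears because cosh is even.\<close>

lemma cosh_le_exp_square_half: "cosh l \<le> exp (l\<^sup>2 / 2)" for l :: real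
proof -
  have "- \<bar>l\<bar> + ln ((1 + exp (2 * \<bar>l\<bar>)) / 2) \<le> l\<^sup>2 / 2"
    using Hoeffdings_lemma_aux[of "2 * \<bar>l\<bar>" "1/2"] by (simp add: power_mult_distrib field_simps)
  hence "exp (- \<bar>l\<bar> + ln ((1 + exp (2 * \<bar>l\<bar>)) / 2)) \<le> exp (l\<^sup>2 / 2)"
    by simp
  also have "exp (- \<bar>l\<bar> + ln ((1 + exp (2 * \<bar>l\<bar>)) / 2)) = exp (- \<bar>l\<bar>) * ((1 + exp (2 * \<bar>l\<bar>)) / 2)"
    by (subst exp_add, subst exp_ln) (auto intro: add_pos_pos)
  also have "\<dots> = cosh \<bar>l\<bar>"
    by (simp add: cosh_def distrib_left exp_add[symmetric] algebra_simps)
  finally show ?thesis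
    by simp
qed

text \<open>The left-hand side is the moment generating function of the difference of two
  independent Bernoulli variables with parameter \<open>p\<close>, that is, of one supply point
  against one demand point.\<close>

lemma symmetric_bernoulli_mgf:
  fixes l p :: real
  assumes "0 \<le> p" "p \<le> 1"
  shows "(1 + (exp l - 1) * p) * (1 + (exp (- l) - 1) * p) \<le> exp (l\<^sup>2 / 2)"
proof -
  have *: "exp l * exp (- l) = 1"
    by (simp add: exp_add[symmetric])
  have "(1 + (exp l - 1) * p) * (1 + (exp (- l) - 1) * p) =
      1 + p * (1 - p) * (exp l + exp (- l) - 2) + p * p * (exp l * exp (- l) - 1)"
    by (simp add: algebra_simps)
  also have "\<dots> = 1 + p * (1 - p) * (2 * cosh l - 2)"
    by (simp add: * cosh_def)
  \<comment> \<open>The variance factor \<open>p * (1 - p)\<close> is at most 1/4; the bound 1/2 is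
    chosen because it makes the expression collapse to \<open>cosh l\<close>.\<close>
  also have "\<dots> \<le> 1 + 1 / 2 * (2 * cosh l - 2)"
  proof -
    have "p * (1 - p) \<le> 1 / 2"
      using mult_const_minus_self_real_le[of p 1] by simp
    thus ?thesis
      using cosh_real_ge_1[of l] by (intro add_left_mono mult_right_mono) auto
  qed
  also have "1 + 1 / 2 * (2 * cosh l - 2) = cosh l"
    by (simp add: field_simps)
  also have "\<dots> \<le> exp (l\<^sup>2 / 2)"
    by (rule cosh_le_exp_square_half)
  finally show ?thesis .
qed

section \<open>The imbalance profile for fixed points: bounds, integrability, negation\<close>

lemma imbalance_eq_sum:
  "real_of_int (imbalance n u v e x) =
     (\<Sum>i<n. indicator (segment e x) (u i)) - (\<Sum>i<n. indicator (segment e x) (v i))"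
proof -
  have "real (card {i \<in> {..<n}. w i \<in> A}) = (\<Sum>i<n. indicator A (w i))" for w :: "nat \<Rightarrow> 'a \<times> real" and A
    using sum.inter_filter[of "{..<n}" "\<lambda>_. 1 :: real" "\<lambda>i. w i \<in> A"] by (simp add: indicator_def of_bool_def)
  thus ?thesis
    by (simp add: imbalance_def)
qed

lemma abs_imbalance_le: "\<bar>real_of_int (imbalance n u v e x)\<bar> \<le> n"
proof -
  have "card {i \<in> {..<n}. w i \<in> segment e x} \<le> n" for w :: "nat \<Rightarrow> 'a \<times> real"
    using card_mono[of "{..<n}" "{i \<in> {..<n}. w i \<in> segment e x}"] by auto
  from this[of u] this[of v] show ?thesis
    by (simp add: imbalance_def)
qed

lemma borel_measurable_imbalance [measurable]:
  "(\<lambda>x. real_of_int (imbalance n u v e x)) \<in> borel_measurable borel"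
proof -
  have [measurable]: "(\<lambda>x. indicator (segment e x) z :: real) \<in> borel_measurable borel" for z
  proof -
    \<comment> \<open>With \<open>z\<close> fixed and \<open>x\<close> growing, \<open>z\<close>
      enters the segment at \<open>snd z\<close> and stays, so each point contributes a single
      step.\<close>
    have "(\<lambda>x. indicator (segment e x) z :: real) =
        (if fst z = e \<and> 0 \<le> snd z then indicator {snd z..} else (\<lambda>_. 0))"
      by (cases z) (auto simp: segment_def fun_eq_iff indicator_def)
    thus ?thesis
      by simp
  qed
  show ?thesis
    unfolding imbalance_eq_sum by measurable
qed

text \<open>The profile takes values in the compact interval from \<open>-n\<close> to
  \<open>n\<close>, on which a continuous \<open>h\<close> is bounded. The general \<open>h\<close>
  covers absolute values, shifted absolute values and exponentials alike.\<close>

lemma set_integrable_imbalance: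
  assumes "continuous_on UNIV h"
  shows "set_integrable lborel {a..b} (\<lambda>x. h (real_of_int (imbalance n u v e x)) :: real)"
proof -
  have "bounded (h ` {- real n..real n})"
    by (intro compact_imp_bounded compact_continuous_image continuous_on_subset[OF assms]) auto
  then obtain K where "\<forall>z \<in> h ` {- real n..real n}. norm z \<le> K"
    unfolding bounded_iff by blast
  hence K: "\<bar>h y\<bar> \<le> K" if "\<bar>y\<bar> \<le> n" for y :: real
    using that by (simp add: abs_le_iff)
  have [measurable]: "h \<in> borel_measurable borel"
    using assms by (rule borel_measurable_continuous_onI)
  have "set_integrable lborel {a..b} (\<lambda>_. K)"
    unfolding set_integrable_def
    by (intro integrable_scaleR_left integrable_real_indicator) (auto simp: emeasure_lborel_Icc_eq)
  moreover have "set_borel_measurable lborel {a..b} (\<lambda>x. h (real_of_int (imbalance n u v e x)))"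
    by (simp add: set_borel_measurable_def)
  ultimately show ?thesis
    by (rule set_integrable_bound) (auto intro!: AE_I2 order.trans[OF K[OF abs_imbalance_le]])
qed

text \<open>The cost is even in the pair of profile and flow and the constraint is linear. One
  implication suffices because negation is an involution.\<close>

lemma optimal_solution_uminus:
  "optimal_solution len v_minus v_plus (\<lambda>e x. - S e x) (- c) \<longleftrightarrow>
   optimal_solution len v_minus v_plus S c"
proof -
  have cost: "total_cost len (\<lambda>e x. - S e x) (- c) = total_cost len S c" for S c
  proof -
    have "(\<lambda>x. \<bar>- real_of_int (S e x) + real_of_int (c $ e)\<bar>) = (\<lambda>x. \<bar>real_of_int (S e x) - real_of_int (c $ e)\<bar>)" for e
      by (auto simp: fun_eq_iff)
    thus ?thesis
      by (simp add: total_cost_def Psi_def)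
  qed
  have feas: "feasible len v_minus v_plus (\<lambda>e x. - S e x) (- c) \<longleftrightarrow> feasible len v_minus v_plus S c" for S c
    by (simp add: feasible_def vec_eq_iff matrix_vector_mult_def sum_negf)
  have "optimal_solution len v_minus v_plus (\<lambda>e x. - S e x) (- c)"
    if "optimal_solution len v_minus v_plus S c" for S c
    unfolding optimal_solution_def is_arg_min_def
  proof (intro conjI notI)
    show "feasible len v_minus v_plus (\<lambda>e x. - S e x) (- c)"
      using that by (simp add: feas optimal_solution_def is_arg_min_def)
  next
    assume "\<exists>c'. feasible len v_minus v_plus (\<lambda>e x. - S e x) c' \<and>
              total_cost len (\<lambda>e x. - S e x) c' < total_cost len (\<lambda>e x. - S e x) (- c)"
    then obtain c' where "feasible len v_minus v_plus (\<lambda>e x. - S e x) (- (- c'))"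
      "total_cost len (\<lambda>e x. - S e x) (- (- c')) < total_cost len (\<lambda>e x. - S e x) (- c)"
      by auto
    thus False
      using that unfolding feas cost optimal_solution_def is_arg_min_def by blast
  qed
  from this[of S c] this[of "\<lambda>e x. - S e x" "- c"] show ?thesis
    by auto
qed

lemma imbalance_cong:
  assumes "\<And>i. i < n \<Longrightarrow> u i = u' i" "\<And>i. i < n \<Longrightarrow> v i = v' i"
  shows "imbalance n u v = imbalance n u' v'"
proof -
  have "{i \<in> {..<n}. u i \<in> segment e x} = {i \<in> {..<n}. u' i \<in> segment e x}"
    "{i \<in> {..<n}. v i \<in> segment e x} = {i \<in> {..<n}. v' i \<in> segment e x}" for e x
    using assms by auto
  thus ?thesis
    by (simp add: imbalance_def fun_eq_iff)
qed

section \<open>The product space of all sample points and its exchange symmetry\<close>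

locale network_measure = prob_space \<mu>
  for len :: "'e::finite \<Rightarrow> real" and \<mu> :: "('e \<times> real) measure" +
  assumes len_nonneg: "\<And>e. 0 \<le> len e"
    and space_eq: "space \<mu> = locations len"
    and segments: "\<And>e x. 0 \<le> x \<Longrightarrow> x \<le> len e \<Longrightarrow> segment e x \<in> sets \<mu>"
begin

text \<open>\<open>Inl\<close> marks supply points and \<open>Inr\<close> demand points. With a
  common law, all \<open>2 * n\<close> points form one i.i.d. family, and exchanging supply and
  demand is a permutation of its coordinates.\<close>

definition indices :: "nat \<Rightarrow> (nat + nat) set" where
  "indices n = {..<n} <+> {..<n}"

definition samples :: "nat \<Rightarrow> (nat + nat \<Rightarrow> 'e \<times> real) measure" where
  "samples n = (\<Pi>\<^sub>M j\<in>indices n. \<mu>)"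

definition profile :: "nat \<Rightarrow> (nat + nat \<Rightarrow> 'e \<times> real) \<Rightarrow> 'e \<Rightarrow> real \<Rightarrow> int" where
  "profile n y = imbalance n (y \<circ> Inl) (y \<circ> Inr)"

definition swap :: "nat \<Rightarrow> (nat + nat \<Rightarrow> 'e \<times> real) \<Rightarrow> (nat + nat \<Rightarrow> 'e \<times> real)" where
  "swap n y = (\<lambda>j\<in>indices n. y (case_sum Inr Inl j))"

lemma indices [simp]: "finite (indices n)" "Inl i \<in> indices n \<longleftrightarrow> i < n" "Inr i \<in> indices n \<longleftrightarrow> i < n"
  by (auto simp: indices_def)

lemma sum_indices: "(\<Sum>j\<in>indices n. g j) = (\<Sum>i<n. g (Inl i)) + (\<Sum>i<n. g (Inr i))"
  by (simp add: indices_def sum.Plus)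

lemma prod_indices: "(\<Prod>j\<in>indices n. g j) = (\<Prod>i<n. g (Inl i)) * (\<Prod>i<n. g (Inr i))"
  by (simp add: indices_def prod.Plus)

lemma prob_space_samples: "prob_space (samples n)"
  unfolding samples_def by (intro prob_space_PiM prob_space_axioms)

lemma measurable_sample [measurable]: "i < n \<Longrightarrow> (\<lambda>y. y (Inl i)) \<in> samples n \<rightarrow>\<^sub>M \<mu>"
  "i < n \<Longrightarrow> (\<lambda>y. y (Inr i)) \<in> samples n \<rightarrow>\<^sub>M \<mu>"
  unfolding samples_def by (auto intro!: measurable_component_singleton)

text \<open>Permuting the coordinates of a product of identical factors preserves the product
  measure.\<close>

lemma distr_swap: "distr (samples n) (samples n) (swap n) = samples n"
  and measurable_swap [measurable]: "swap n \<in> samples n \<rightarrow>\<^sub>M samples n"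
proof -
  have *: "inj_on (case_sum Inr Inl :: nat + nat \<Rightarrow> nat + nat) (indices n)"
    "(case_sum Inr Inl :: nat + nat \<Rightarrow> nat + nat) \<in> indices n \<rightarrow> indices n"
    by (auto simp: inj_on_def indices_def)
  from distr_PiM_reindex[OF prob_space_axioms *]
  show "distr (samples n) (samples n) (swap n) = samples n"
    by (simp add: samples_def swap_def[abs_def])
  show "swap n \<in> samples n \<rightarrow>\<^sub>M samples n"
    unfolding samples_def swap_def[abs_def]
    using * by (intro measurable_restrict measurable_component_singleton) auto
qed

lemma profile_swap: "profile n (swap n y) = imbalance n (y \<circ> Inr) (y \<circ> Inl)"
  unfolding profile_def by (rule imbalance_cong) (auto simp: swap_def)

lemma profile_swap_uminus: "profile n (swap n y) = (\<lambda>e x. - profile n y e x)"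
  unfolding profile_swap by (simp add: profile_def imbalance_def fun_eq_iff)

lemma borel_measurable_indicator_segment [measurable (raw)]:
  assumes f [measurable]: "f \<in> N \<rightarrow>\<^sub>M \<mu>" and g [measurable]: "g \<in> borel_measurable N"
  shows "(\<lambda>w. indicator (segment e (g w)) (f w) :: real) \<in> borel_measurable N"
proof -
  \<comment> \<open>The \<open>\<sigma>\<close>-algebra of \<open>\<mu>\<close> is abstract, so joint measurability has to come from the segments alone.\<close>
  define position where "position z = snd z * indicator (segment e (len e)) z" for z
  have [measurable]: "segment e (len e) \<in> sets \<mu>"
    using segments len_nonneg by auto
  have [measurable]: "position \<in> borel_measurable \<mu>"
  proof (rule borel_measurable_iff_le[THEN iffD2], rule)
    fix x
    \<comment> \<open>Off the edge \<open>e\<close>, \<open>position\<close> is 0. Hence for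
      nonnegative \<open>x\<close> the sublevel set omits only the part of the edge beyond
      \<open>x\<close>, a difference of two segments.\<close>
    have "{z \<in> space \<mu>. position z \<le> x} =
        (if x < 0 then {} else if len e < x then space \<mu> else space \<mu> - (segment e (len e) - segment e x))"
      using len_nonneg[of e] by (auto simp: position_def segment_def indicator_def)
    moreover have "segment e x \<in> sets \<mu>" if "\<not> x < 0" "\<not> len e < x"
      using segments that by auto
    ultimately show "{z \<in> space \<mu>. position z \<le> x} \<in> sets \<mu>"
      by auto
  qed
  \<comment> \<open>The first factor discards other edges, where \<open>position\<close> is a dummy
    0. Since \<open>f w\<close> is a location, the identity also holds when \<open>g w\<close> is
    negative or exceeds \<open>len e\<close>.\<close>
  have "indicator (segment e (g w)) (f w) =
      (indicator (segment e (len e)) (f w) * of_bool (position (f w) \<le> g w) :: real)" if "w \<in> space N" for w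
    using measurable_space[OF f that] by (auto simp: space_eq locations_def position_def segment_def indicator_def)
  moreover have "(\<lambda>w. indicator (segment e (len e)) (f w) * of_bool (position (f w) \<le> g w) :: real) \<in> borel_measurable N"
    by measurable
  ultimately show ?thesis
    by (subst measurable_cong) auto
qed

text \<open>Joint measurability in sample and position, as required for exchanging expectation and
  integration along an edge.\<close>

lemma borel_measurable_profile [measurable (raw)]:
  assumes [measurable]: "Y \<in> N \<rightarrow>\<^sub>M samples n" "g \<in> borel_measurable N"
  shows "(\<lambda>w. real_of_int (profile n (Y w) e (g w))) \<in> borel_measurable N"
proof -
  have "(\<lambda>w. Y w (Inl i)) \<in> N \<rightarrow>\<^sub>M \<mu>" "(\<lambda>w. Y w (Inr i)) \<in> N \<rightarrow>\<^sub>M \<mu>" if "i < n" for i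
    using measurable_compose[OF assms(1) measurable_sample(1)[OF that]]
      measurable_compose[OF assms(1) measurable_sample(2)[OF that]] by auto
  thus ?thesis
    unfolding profile_def imbalance_eq_sum comp_def
    by (intro borel_measurable_diff borel_measurable_sum borel_measurable_indicator_segment assms) auto
qed

text \<open>By independence the expectation is a product over the \<open>2 * n\<close> points; each
  supply factor is paired with a demand factor and bounded by
  \<open>symmetric_bernoulli_mgf\<close>.\<close>

lemma nn_integral_exp_profile:
  "(\<integral>\<^sup>+y. ennreal (exp (l * real_of_int (profile n y e x))) \<partial>samples n) \<le> ennreal (exp (n * l\<^sup>2 / 2))"
proof -
  interpret pm: product_sigma_finite "\<lambda>_ :: nat + nat. \<mu>"
    by (intro product_sigma_finite.intro sigma_finite_measure_axioms)
  define p :: real where "p = expectation (indicator (segment e x))"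
  have [measurable]: "(indicator (segment e x) :: _ \<Rightarrow> real) \<in> borel_measurable \<mu>"
    using borel_measurable_indicator_segment[of "\<lambda>z. z" \<mu> "\<lambda>_. x" e] by simp
  have int: "integrable \<mu> (indicator (segment e x) :: _ \<Rightarrow> real)"
    by (rule integrable_const_bound[where B = 1]) auto
  have p: "0 \<le> p" "p \<le> 1"
  proof -
    show "0 \<le> p"
      unfolding p_def by (intro integral_nonneg_AE) auto
    have "p \<le> expectation (\<lambda>_. 1)"
      unfolding p_def by (intro integral_mono int) (auto simp: indicator_def)
    thus "p \<le> 1"
      by (simp add: prob_space)
  qed
  have factor: "(\<integral>\<^sup>+z. ennreal (exp (k * indicator (segment e x) z)) \<partial>\<mu>) = ennreal (1 + (exp k - 1) * p)" for k :: real
  proof -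
    \<comment> \<open>On the values 0 and 1 the exponential agrees with an affine function, whose
      expectation is immediate.\<close>
    have "exp (k * indicator (segment e x) z) = 1 + (exp k - 1) * indicator (segment e x) z" for z :: "'e \<times> real"
      by (auto simp: indicator_def)
    moreover have "(\<integral>\<^sup>+z. ennreal (1 + (exp k - 1) * indicator (segment e x) z) \<partial>\<mu>)
        = ennreal (expectation (\<lambda>z. 1 + (exp k - 1) * indicator (segment e x) z))"
      using int by (intro nn_integral_eq_integral) (auto simp: indicator_simps split: split_indicator)
    ultimately show ?thesis
      using int by (simp add: p_def prob_space)
  qed
  have pos: "0 \<le> 1 + (exp k - 1) * p" for k :: real
  proof -
    have "1 + (exp k - 1) * p = (1 - p) + exp k * p"
      by (simp add: algebra_simps)
    also have "\<dots> \<ge> 0"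
      using p by (intro add_nonneg_nonneg mult_nonneg_nonneg) auto
    finally show ?thesis .
  qed
  define s where "s = case_sum (\<lambda>_ :: nat. l) (\<lambda>_ :: nat. - l)"
  have "exp (l * real_of_int (profile n y e x)) = (\<Prod>j\<in>indices n. exp (s j * indicator (segment e x) (y j)))" for y
    unfolding exp_sum[OF indices(1), symmetric] sum_indices
    by (simp add: profile_def imbalance_eq_sum s_def sum_distrib_left sum_negf right_diff_distrib)
  hence "(\<integral>\<^sup>+y. ennreal (exp (l * real_of_int (profile n y e x))) \<partial>samples n) =
      (\<integral>\<^sup>+y. (\<Prod>j\<in>indices n. ennreal (exp (s j * indicator (segment e x) (y j)))) \<partial>samples n)"
    by (simp add: prod_ennreal)
  also have "\<dots> = (\<Prod>j\<in>indices n. \<integral>\<^sup>+z. ennreal (exp (s j * indicator (segment e x) z)) \<partial>\<mu>)"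
    unfolding samples_def by (rule pm.product_nn_integral_prod) auto
  also have "\<dots> = ennreal (((1 + (exp l - 1) * p) * (1 + (exp (- l) - 1) * p)) ^ n)"
    using pos[of l] pos[of "- l"] unfolding factor prod_indices s_def
    by (simp add: ennreal_power ennreal_mult power_mult_distrib)
  also have "\<dots> \<le> ennreal (exp (l\<^sup>2 / 2) ^ n)"
    using p pos by (intro ennreal_leI power_mono symmetric_bernoulli_mgf mult_nonneg_nonneg)
  also have "exp (l\<^sup>2 / 2) ^ n = exp (n * l\<^sup>2 / 2)"
    by (simp add: exp_of_nat_mult[symmetric])
  finally show ?thesis .
qed

text \<open>The exponential of the absolute value is at most the sum of the exponentials for
  \<open>l\<close> and \<open>-l\<close>; this produces the factor 2 of the tail bound.\<close>

lemma nn_integral_exp_abs_profile: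
  "(\<integral>\<^sup>+y. ennreal (exp (l * \<bar>real_of_int (profile n y e x)\<bar>)) \<partial>samples n) \<le> ennreal (2 * exp (n * l\<^sup>2 / 2))"
proof -
  have "(\<integral>\<^sup>+y. ennreal (exp (l * \<bar>real_of_int (profile n y e x)\<bar>)) \<partial>samples n) \<le>
      (\<integral>\<^sup>+y. ennreal (exp (l * real_of_int (profile n y e x))) + ennreal (exp ((- l) * real_of_int (profile n y e x))) \<partial>samples n)"
    by (intro nn_integral_mono) (auto simp: abs_if ennreal_plus[symmetric] simp del: ennreal_plus intro!: ennreal_leI)
  also have "\<dots> \<le> ennreal (exp (n * l\<^sup>2 / 2)) + ennreal (exp (n * (- l)\<^sup>2 / 2))"
    using nn_integral_exp_profile[where l = l] nn_integral_exp_profile[where l = "- l"]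
    by (subst nn_integral_add) (auto intro!: add_mono)
  also have "\<dots> = ennreal (2 * exp (n * l\<^sup>2 / 2))"
    by (simp add: ennreal_plus[symmetric] del: ennreal_plus)
  finally show ?thesis .
qed

section \<open>Tail bound\<close>

text \<open>The bound of \<open>optimal_solution_bound\<close> with its coefficient as a parameter:
  absolute imbalance integrated with weight \<open>\<alpha>\<close> along each edge, plus an atom of
  weight 1 at the end of the edge.\<close>

definition variation :: "real \<Rightarrow> nat \<Rightarrow> (nat + nat \<Rightarrow> 'e \<times> real) \<Rightarrow> real" where
  "variation \<alpha> n y = (\<Sum>f\<in>UNIV. \<alpha> * integral {0..len f} (\<lambda>x. \<bar>real_of_int (profile n y f x)\<bar>)
                                + \<bar>real_of_int (profile n y f (len f))\<bar>)"

text \<open>The total weight in \<open>variation\<close>, so that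
  \<open>variation \<alpha> n y / mass \<alpha>\<close> is a weighted mean of absolute
  imbalances.\<close>

definition mass :: "real \<Rightarrow> real" where
  "mass \<alpha> = (\<Sum>f\<in>UNIV. \<alpha> * len f + 1)"

lemma
  assumes "continuous_on UNIV h"
  shows integrable_profile: "(\<lambda>x. h (real_of_int (profile n y e x)) :: real) integrable_on {a..b}"
    and integral_profile: "integral {a..b} (\<lambda>x. h (real_of_int (profile n y e x)) :: real) =
          (LINT x:{a..b}|lborel. h (real_of_int (profile n y e x)))"
proof -
  note * = set_borel_integral_eq_integral[OF set_integrable_imbalance[OF assms],
    where u1 = "y \<circ> Inl" and v1 = "y \<circ> Inr"]
  show "(\<lambda>x. h (real_of_int (profile n y e x)) :: real) integrable_on {a..b}"
    unfolding profile_def by (rule *(1))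
  show "integral {a..b} (\<lambda>x. h (real_of_int (profile n y e x)) :: real) =
      (LINT x:{a..b}|lborel. h (real_of_int (profile n y e x)))"
    unfolding profile_def by (rule *(2)[symmetric])
qed

lemma mass_pos: "0 \<le> \<alpha> \<Longrightarrow> 0 < mass \<alpha>"
  unfolding mass_def using len_nonneg by (intro sum_pos add_nonneg_pos mult_nonneg_nonneg) auto

text \<open>Jensen's inequality for the exponential and the weights of \<open>variation\<close>,
  multiplied by the total weight.\<close>

lemma exp_variation_le:
  assumes "0 \<le> \<alpha>"
  shows "mass \<alpha> * exp (l * (variation \<alpha> n y / mass \<alpha>)) \<le>
    (\<Sum>f\<in>UNIV. \<alpha> * integral {0..len f} (\<lambda>x. exp (l * \<bar>real_of_int (profile n y f x)\<bar>))
                + exp (l * \<bar>real_of_int (profile n y f (len f))\<bar>))"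
proof -
  define w where "w = variation \<alpha> n y / mass \<alpha>"
  \<comment> \<open>the tangent of \<open>exp (l * s)\<close> at the mean \<open>w\<close>, whose integral is exact\<close>
  define T where "T s = exp (l * w) * (1 - l * w) + exp (l * w) * l * s" for s
  have T: "T s \<le> exp (l * s)" for s
  proof -
    have "T s = exp (l * w) * (1 + l * (s - w))"
      by (simp add: T_def algebra_simps)
    also have "\<dots> \<le> exp (l * w) * exp (l * (s - w))"
      using exp_ge_add_one_self[of "l * (s - w)"] by (intro mult_left_mono) auto
    also have "\<dots> = exp (l * s)"
      by (simp add: exp_add[symmetric] algebra_simps)
    finally show ?thesis .
  qed
  have int: "(\<lambda>x. \<bar>real_of_int (profile n y f x)\<bar>) integrable_on {0..len f}" for f
    using integrable_profile[of "\<lambda>s. \<bar>s\<bar>"] by (simp add: continuous_on_rabs)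
  have T_int: "integral {0..len f} (\<lambda>x. T \<bar>real_of_int (profile n y f x)\<bar>) =
      exp (l * w) * (1 - l * w) * len f + exp (l * w) * l * integral {0..len f} (\<lambda>x. \<bar>real_of_int (profile n y f x)\<bar>)" for f
    unfolding T_def using int[of f] len_nonneg[of f]
    by (subst integral_add) (auto intro: integrable_on_mult_right)
  have "mass \<alpha> * exp (l * w) = exp (l * w) * (1 - l * w) * mass \<alpha> + exp (l * w) * l * variation \<alpha> n y"
    using mass_pos[OF assms] by (simp add: w_def algebra_simps)
  also have "\<dots> = (\<Sum>f\<in>UNIV. \<alpha> * integral {0..len f} (\<lambda>x. T \<bar>real_of_int (profile n y f x)\<bar>)
                + T \<bar>real_of_int (profile n y f (len f))\<bar>)"
    unfolding T_int unfolding T_def variation_def mass_def sum_distrib_left sum.distrib[symmetric]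
    by (intro sum.cong) (auto simp: algebra_simps)
  also have "\<dots> \<le> (\<Sum>f\<in>UNIV. \<alpha> * integral {0..len f} (\<lambda>x. exp (l * \<bar>real_of_int (profile n y f x)\<bar>))
                + exp (l * \<bar>real_of_int (profile n y f (len f))\<bar>))"
  proof (intro sum_mono add_mono mult_left_mono integral_le T assms)
    fix f
    show "(\<lambda>x. T \<bar>real_of_int (profile n y f x)\<bar>) integrable_on {0..len f}"
      by (rule integrable_profile) (auto simp: T_def intro!: continuous_intros)
    show "(\<lambda>x. exp (l * \<bar>real_of_int (profile n y f x)\<bar>)) integrable_on {0..len f}"
      by (rule integrable_profile) (auto intro!: continuous_intros)
  qed
  finally show ?thesis
    by (simp add: w_def)
qed

text \<open>Rewriting the integral as a Lebesgue integral makes its measurability in the sample a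
  consequence of joint measurability.\<close>

lemma borel_measurable_integral_profile [measurable]:
  assumes "continuous_on UNIV h"
  shows "(\<lambda>y. integral {a..b} (\<lambda>x. h (real_of_int (profile n y e x))) :: real) \<in> borel_measurable (samples n)"
proof -
  have [measurable]: "h \<in> borel_measurable borel"
    using assms by (rule borel_measurable_continuous_onI)
  show ?thesis
    unfolding integral_profile[OF assms] set_lebesgue_integral_def by measurable
qed

lemma borel_measurable_variation [measurable]: "variation \<alpha> n \<in> borel_measurable (samples n)"
proof -
  have [measurable]: "(\<lambda>y. integral {0..len f} (\<lambda>x. \<bar>real_of_int (profile n y f x)\<bar>)) \<in> borel_measurable (samples n)" for f
    by (rule borel_measurable_integral_profile) (auto intro!: continuous_intros)
  show ?thesis
    unfolding variation_def[abs_def] by measurable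
qed

text \<open>Jensen's inequality moves the exponential inside the mean, and Tonelli's theorem the
  expectation. There every edge and position obeys the same bound \<open>E\<close>, so the weights
  add up to \<open>mass \<alpha>\<close>, which cancels.\<close>

lemma variation_mgf:
  assumes "0 \<le> \<alpha>"
  shows "(\<integral>\<^sup>+y. ennreal (exp (l * (variation \<alpha> n y / mass \<alpha>))) \<partial>samples n) \<le> ennreal (2 * exp (n * l\<^sup>2 / 2))"
proof -
  interpret samples: prob_space "samples n"
    by (rule prob_space_samples)
  interpret pair: pair_sigma_finite lborel "samples n"
    by unfold_locales
  define E where "E = 2 * exp (n * l\<^sup>2 / 2)"
  define g where "g f y x = exp (l * \<bar>real_of_int (profile n y f x)\<bar>)" for f y x
  have E: "0 \<le> E" "(\<integral>\<^sup>+y. ennreal (g f y x) \<partial>samples n) \<le> ennreal E" for f x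
    unfolding E_def g_def by (simp, rule nn_integral_exp_abs_profile)
  have [measurable]: "(\<lambda>y. g f y x) \<in> borel_measurable (samples n)" for f x
    unfolding g_def by measurable
  have g_int: "ennreal (integral {0..len f} (g f y)) = (\<integral>\<^sup>+x. ennreal (g f y x) * indicator {0..len f} x \<partial>lborel)" for f y
  proof -
    have h: "continuous_on UNIV (\<lambda>s. exp (l * \<bar>s\<bar>))"
      by (intro continuous_intros)
    have "integral {0..len f} (g f y) = integral\<^sup>L lborel (\<lambda>x. g f y x * indicator {0..len f} x)"
      using integral_profile[OF h] by (simp add: g_def[abs_def] set_lebesgue_integral_def mult.commute)
    moreover have "integrable lborel (\<lambda>x. g f y x * indicator {0..len f} x)"
      using set_integrable_imbalance[OF h] by (simp add: g_def[abs_def] profile_def set_integrable_def mult.commute)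
    ultimately have "ennreal (integral {0..len f} (g f y)) = (\<integral>\<^sup>+x. ennreal (g f y x * indicator {0..len f} x) \<partial>lborel)"
      by (simp add: nn_integral_eq_integral g_def)
    also have "\<dots> = (\<integral>\<^sup>+x. ennreal (g f y x) * indicator {0..len f} x \<partial>lborel)"
      by (intro nn_integral_cong) (simp add: indicator_def)
    finally show ?thesis .
  qed
  have int_nonneg: "0 \<le> integral {0..len f} (g f y)" for f y
  proof -
    have "g f y integrable_on {0..len f}"
      unfolding g_def[abs_def] by (rule integrable_profile) (intro continuous_intros)
    thus ?thesis
      by (rule integral_nonneg) (simp add: g_def)
  qed
  have [measurable]: "(\<lambda>y. integral {0..len f} (g f y)) \<in> borel_measurable (samples n)" for f
    unfolding g_def[abs_def] by (rule borel_measurable_integral_profile) (intro continuous_intros)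
  have fubini: "(\<integral>\<^sup>+y. ennreal (integral {0..len f} (g f y)) \<partial>samples n) \<le> ennreal (E * len f)" for f
  proof -
    have "(\<integral>\<^sup>+y. ennreal (integral {0..len f} (g f y)) \<partial>samples n) =
        (\<integral>\<^sup>+y. \<integral>\<^sup>+x. ennreal (g f y x) * indicator {0..len f} x \<partial>lborel \<partial>samples n)"
      by (simp add: g_int)
    also have "\<dots> = (\<integral>\<^sup>+x. \<integral>\<^sup>+y. ennreal (g f y x) * indicator {0..len f} x \<partial>samples n \<partial>lborel)"
      by (rule pair.Fubini') (simp add: g_def)
    also have "\<dots> = (\<integral>\<^sup>+x. (\<integral>\<^sup>+y. ennreal (g f y x) \<partial>samples n) * indicator {0..len f} x \<partial>lborel)"
      by (simp add: nn_integral_multc)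
    also have "\<dots> \<le> (\<integral>\<^sup>+x. ennreal E * indicator {0..len f} x \<partial>lborel)"
      by (intro nn_integral_mono mult_right_mono E) auto
    also have "\<dots> = ennreal (E * len f)"
      using len_nonneg[of f] E(1) by (simp add: nn_integral_cmult ennreal_mult)
    finally show ?thesis .
  qed
  have "ennreal (mass \<alpha>) * (\<integral>\<^sup>+y. ennreal (exp (l * (variation \<alpha> n y / mass \<alpha>))) \<partial>samples n) =
      (\<integral>\<^sup>+y. ennreal (mass \<alpha> * exp (l * (variation \<alpha> n y / mass \<alpha>))) \<partial>samples n)"
    using mass_pos[OF assms] by (simp add: nn_integral_cmult ennreal_mult less_imp_le)
  also have "\<dots> \<le> (\<integral>\<^sup>+y. (\<Sum>f\<in>UNIV. ennreal \<alpha> * ennreal (integral {0..len f} (g f y)) + ennreal (g f y (len f))) \<partial>samples n)"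
  proof (rule nn_integral_mono)
    fix y
    have "ennreal (mass \<alpha> * exp (l * (variation \<alpha> n y / mass \<alpha>))) \<le>
       ennreal (\<Sum>f\<in>UNIV. \<alpha> * integral {0..len f} (g f y) + g f y (len f))"
      using exp_variation_le[OF assms] by (intro ennreal_leI) (simp add: g_def[abs_def])
    also have "\<dots> = (\<Sum>f\<in>UNIV. ennreal (\<alpha> * integral {0..len f} (g f y) + g f y (len f)))"
      using assms int_nonneg by (subst sum_ennreal) (auto simp: g_def)
    also have "\<dots> = (\<Sum>f\<in>UNIV. ennreal \<alpha> * ennreal (integral {0..len f} (g f y)) + ennreal (g f y (len f)))"
      using assms int_nonneg by (intro sum.cong) (auto simp: g_def ennreal_mult)
    finally show "ennreal (mass \<alpha> * exp (l * (variation \<alpha> n y / mass \<alpha>))) \<le>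
       (\<Sum>f\<in>UNIV. ennreal \<alpha> * ennreal (integral {0..len f} (g f y)) + ennreal (g f y (len f)))" .
  qed
  also have "\<dots> = (\<Sum>f\<in>UNIV. ennreal \<alpha> * (\<integral>\<^sup>+y. ennreal (integral {0..len f} (g f y)) \<partial>samples n)
      + (\<integral>\<^sup>+y. ennreal (g f y (len f)) \<partial>samples n))"
    by (simp add: nn_integral_sum nn_integral_add nn_integral_cmult)
  also have "\<dots> \<le> (\<Sum>f\<in>UNIV. ennreal \<alpha> * ennreal (E * len f) + ennreal E)"
    by (intro sum_mono add_mono mult_left_mono fubini E) auto
  also have "\<dots> = (\<Sum>f\<in>UNIV. ennreal (\<alpha> * (E * len f) + E))"
    using assms E(1) len_nonneg by (intro sum.cong) (auto simp: ennreal_mult)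
  also have "\<dots> = ennreal (\<Sum>f\<in>UNIV. \<alpha> * (E * len f) + E)"
    using assms E(1) len_nonneg by (intro sum_ennreal) auto
  also have "(\<Sum>f\<in>UNIV. \<alpha> * (E * len f) + E) = mass \<alpha> * E"
    unfolding mass_def sum_distrib_right by (intro sum.cong) (auto simp: algebra_simps)
  also have "ennreal (mass \<alpha> * E) = ennreal (mass \<alpha>) * ennreal E"
    using mass_pos[OF assms] E(1) by (simp add: ennreal_mult)
  finally show ?thesis
    using mass_pos[OF assms] unfolding E_def
    by (subst (asm) ennreal_mult_le_mult_iff) auto
qed

text \<open>Chernoff's bound from \<open>variation_mgf\<close>. It needs a positive exponent, so
  \<open>t = 0\<close> is treated apart; there the right-hand side is 2.\<close>

lemma variation_tail:
  assumes "0 \<le> \<alpha>" "0 < n" "0 \<le> t"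
  shows "measure (samples n) {y \<in> space (samples n). t \<le> variation \<alpha> n y} \<le>
           2 * exp (- (t\<^sup>2 / (2 * (mass \<alpha>)\<^sup>2 * n)))"
proof (cases "t = 0")
  case True
  interpret samples: prob_space "samples n"
    by (rule prob_space_samples)
  show ?thesis
    using True order.trans[OF samples.prob_le_1, of 2] by simp
next
  case False
  interpret samples: prob_space "samples n"
    by (rule prob_space_samples)
  define a where "a = mass \<alpha>"
  \<comment> \<open>The minimiser of the exponent \<open>n * l^2 / 2 - l * (t / a)\<close>.\<close>
  define l where "l = t / (a * n)"
  have a: "0 < a"
    unfolding a_def by (rule mass_pos) fact
  have "0 < l"
    using a assms False by (simp add: l_def)
  have "emeasure (samples n) {y \<in> space (samples n). t / a \<le> variation \<alpha> n y / a} \<le>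
      ennreal (exp (- l * (t / a))) *
      (\<integral>\<^sup>+y. ennreal (exp (l * (variation \<alpha> n y / a))) * indicator (space (samples n)) y \<partial>samples n)"
    using \<open>0 < l\<close> by (intro Chernoff_ineq_nn_integral_ge) auto
  also have "(\<integral>\<^sup>+y. ennreal (exp (l * (variation \<alpha> n y / a))) * indicator (space (samples n)) y \<partial>samples n) =
      (\<integral>\<^sup>+y. ennreal (exp (l * (variation \<alpha> n y / a))) \<partial>samples n)"
    by (intro nn_integral_cong) auto
  also have "ennreal (exp (- l * (t / a))) * \<dots> \<le> ennreal (exp (- l * (t / a))) * ennreal (2 * exp (n * l\<^sup>2 / 2))"
    unfolding a_def by (intro mult_left_mono variation_mgf assms) auto
  also have "\<dots> = ennreal (2 * exp (n * l\<^sup>2 / 2 - l * (t / a)))"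
    by (simp add: ennreal_mult[symmetric] exp_add[symmetric] exp_diff exp_minus field_simps)
  also have "n * l\<^sup>2 / 2 - l * (t / a) = - (t\<^sup>2 / (2 * a\<^sup>2 * n))"
    using a assms by (simp add: l_def field_simps power2_eq_square)
  also have "{y \<in> space (samples n). t / a \<le> variation \<alpha> n y / a} = {y \<in> space (samples n). t \<le> variation \<alpha> n y}"
    using a by (auto simp: divide_le_cancel)
  finally show ?thesis
    by (simp add: a_def samples.emeasure_eq_measure)
qed

section \<open>Symmetry\<close>

text \<open>Competitors are integer vectors, so optimality is a countable conjunction of comparisons
  between measurable costs.\<close>

lemma pred_optimal_solution [measurable]:
  "Measurable.pred (samples n) (\<lambda>y. optimal_solution len v_minus v_plus (profile n y) c)"
proof -
  have cost [measurable]: "(\<lambda>y. total_cost len (profile n y) c) \<in> borel_measurable (samples n)" for c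
    unfolding total_cost_def Psi_def
    by (intro borel_measurable_sum borel_measurable_integral_profile) (intro continuous_intros)
  have [measurable]: "Measurable.pred (samples n) (\<lambda>y. feasible len v_minus v_plus (profile n y) c)" for c
  proof -
    \<comment> \<open>The constraint is stated over the reals, where measurability of the profile is
      available.\<close>
    have "feasible len v_minus v_plus (profile n y) c \<longleftrightarrow>
        (\<forall>v. real_of_int ((incidence v_minus v_plus *v c) $ v) =
             (\<Sum>f\<in>UNIV. of_bool (v_plus f = v) * real_of_int (profile n y f (len f))))" for y
    proof -
      have "feasible len v_minus v_plus (profile n y) c \<longleftrightarrow>
        (\<forall>v. real_of_int ((incidence v_minus v_plus *v c) $ v) =
             real_of_int (\<Sum>f\<in>UNIV. of_bool (v_plus f = v) * profile n y f (len f)))"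
        unfolding feasible_def vec_eq_iff of_int_eq_iff endpoint_matrix_mult by simp
      thus ?thesis
        by simp
    qed
    thus ?thesis
      by simp
  qed
  show ?thesis
    unfolding optimal_solution_def is_arg_min_def by measurable
qed

text \<open>The chosen solution depends on the sample itself; splitting over its countably many
  values reduces to a fixed \<open>c\<close>.\<close>

lemma pred_optimal_choice:
  fixes opt :: "('e \<Rightarrow> real \<Rightarrow> int) \<Rightarrow> int ^ 'e"
  assumes [measurable]: "\<And>e. (\<lambda>y. opt (profile n y) $ e) \<in> samples n \<rightarrow>\<^sub>M count_space UNIV"
  shows "Measurable.pred (samples n) (\<lambda>y. optimal_solution len v_minus v_plus (profile n y) (opt (profile n y)))"
proof -
  have "(\<lambda>y. optimal_solution len v_minus v_plus (profile n y) (opt (profile n y))) =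
    (\<lambda>y. \<exists>c. (\<forall>e. opt (profile n y) $ e = c $ e) \<and> optimal_solution len v_minus v_plus (profile n y) c)"
    by (auto simp: fun_eq_iff vec_eq_iff[symmetric])
  also have "Measurable.pred (samples n) \<dots>"
    by measurable
  finally show ?thesis .
qed

text \<open>The coefficient \<open>\<alpha>\<close> depends on the network only, which makes the
  variance proxy linear in \<open>n\<close>.\<close>

lemma optimal_solution_variation:
  assumes "no_zero_length_cycle len v_minus v_plus"
  obtains \<alpha> where "0 \<le> \<alpha>"
    "\<And>n y c e. optimal_solution len v_minus v_plus (profile n y) c \<Longrightarrow> \<bar>real_of_int (c $ e)\<bar> \<le> variation \<alpha> n y"
proof
  \<comment> \<open>Inserting 1 keeps the minimum defined when all lengths are 0.\<close>
  define \<delta> where "\<delta> = Min (insert 1 (len ` {f. 0 < len f}))"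
  have "0 < \<delta>" and \<delta>: "\<And>f. 0 < len f \<Longrightarrow> \<delta> \<le> len f"
    unfolding \<delta>_def by (auto simp: Min_gr_iff)
  show "0 \<le> 2 * CARD('e) / \<delta>"
    using \<open>0 < \<delta>\<close> by simp
  show "\<bar>real_of_int (c $ e)\<bar> \<le> variation (2 * CARD('e) / \<delta>) n y"
    if "optimal_solution len v_minus v_plus (profile n y) c" for n y c e
    unfolding variation_def
    by (rule optimal_solution_bound[OF len_nonneg assms that _ \<open>0 < \<delta>\<close> \<delta>])
       (auto intro!: integrable_profile[where h = "\<lambda>s. \<bar>s - k\<bar>" for k] continuous_intros)
qed

text \<open>A deterministic bound, from which integrability of the optimal flow follows.\<close>

lemma variation_le:
  assumes "0 \<le> \<alpha>"
  shows "variation \<alpha> n y \<le> n * mass \<alpha>"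
proof -
  have le: "\<bar>real_of_int (profile n y f x)\<bar> \<le> n" for f x
    unfolding profile_def by (rule abs_imbalance_le)
  have "integral {0..len f} (\<lambda>x. \<bar>real_of_int (profile n y f x)\<bar>) \<le> integral {0..len f} (\<lambda>_. real n)" for f
    by (intro integral_le le integrable_profile[where h = abs] continuous_on_rabs continuous_on_id) auto
  hence "variation \<alpha> n y \<le> (\<Sum>f\<in>UNIV. \<alpha> * (n * len f) + n)"
    unfolding variation_def using assms len_nonneg
    by (intro sum_mono add_mono mult_left_mono le) (simp add: mult.commute)
  also have "\<dots> = n * mass \<alpha>"
    unfolding mass_def sum_distrib_left by (simp add: algebra_simps)
  finally show ?thesis .
qed

lemma AE_samples_swap:
  assumes "AE y in samples n. Q y" "Measurable.pred (samples n) Q"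
  shows "AE y in samples n. Q (swap n y)"
  using assms by (subst (asm) distr_swap[symmetric], subst (asm) AE_distr_iff) auto

text \<open>Almost surely the choices for a sample and for its exchange are both optimal. Negating
  the latter gives an optimal solution of the original instance: either it is the original choice,
  or there are two optimal solutions and sign neutrality applies.\<close>

lemma sign_neutral_choice:
  fixes opt :: "('e \<Rightarrow> real \<Rightarrow> int) \<Rightarrow> int ^ 'e"
  assumes ties: "sign_neutral_ties len v_minus v_plus opt"
    and meas: "\<And>e. (\<lambda>y. opt (profile n y) $ e) \<in> samples n \<rightarrow>\<^sub>M count_space UNIV"
    and optimal: "AE y in samples n. optimal_solution len v_minus v_plus (profile n y) (opt (profile n y))"
  shows "AE y in samples n. opt (profile n (swap n y)) = - opt (profile n y)"
proof -
  from AE_samples_swap[OF optimal pred_optimal_choice[OF meas]] optimal AE_space show ?thesis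
  proof eventually_elim
    fix y
    assume swapped: "optimal_solution len v_minus v_plus (profile n (swap n y)) (opt (profile n (swap n y)))"
      and orig: "optimal_solution len v_minus v_plus (profile n y) (opt (profile n y))"
      and y: "y \<in> space (samples n)"
    have loc: "y \<circ> Inl \<in> {..<n} \<rightarrow> locations len" "y \<circ> Inr \<in> {..<n} \<rightarrow> locations len"
      using y by (auto simp: samples_def space_PiM PiE_def Pi_def space_eq)
    have other: "optimal_solution len v_minus v_plus (profile n y) (- opt (profile n (swap n y)))"
      using swapped optimal_solution_uminus[of len v_minus v_plus "profile n y" "- opt (profile n (swap n y))"]
      by (simp add: profile_swap_uminus)
    show "opt (profile n (swap n y)) = - opt (profile n y)"
    proof (cases "- opt (profile n (swap n y)) = opt (profile n y)")
      case True
      thus ?thesis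
        by (metis minus_minus)
    next
      case False
      hence "opt (imbalance n (y \<circ> Inr) (y \<circ> Inl)) = - opt (imbalance n (y \<circ> Inl) (y \<circ> Inr))"
        using ties loc other orig unfolding sign_neutral_ties_def profile_def by blast
      thus ?thesis
        unfolding profile_swap unfolding profile_def .
    qed
  qed
qed

end

section \<open>Transfer from the product space to the given random variables\<close>

theorem theorem8:
  fixes len :: "'e::finite \<Rightarrow> real"
    and v_minus v_plus :: "'e \<Rightarrow> 'v::finite"
    and \<mu> \<nu> :: "('e \<times> real) measure"
    and M :: "'w measure"
    and U V :: "nat \<Rightarrow> nat \<Rightarrow> 'w \<Rightarrow> 'e \<times> real"
    and opt :: "('e \<Rightarrow> real \<Rightarrow> int) \<Rightarrow> int ^ 'e"
    and c_int :: "nat \<Rightarrow> 'w \<Rightarrow> int ^ 'e"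
  assumes len_nonneg: "\<And>e. 0 \<le> len e"
    and no_zero_cycle: "no_zero_length_cycle len v_minus v_plus"
    and mu: "prob_space \<mu>" "space \<mu> = locations len"
    and nu: "prob_space \<nu>" "sets \<nu> = sets \<mu>"
    and segments: "\<And>e x. 0 \<le> x \<Longrightarrow> x \<le> len e \<Longrightarrow> segment e x \<in> sets \<mu>"
    and M: "prob_space M"
    and indep: "\<And>n. prob_space.indep_vars M (case_sum (\<lambda>_. \<mu>) (\<lambda>_. \<nu>))
                  (case_sum (U n) (V n)) ({..<n} <+> {..<n})"
    and distr_U: "\<And>n i. i < n \<Longrightarrow> distr M \<mu> (U n i) = \<mu>"
    and distr_V: "\<And>n i. i < n \<Longrightarrow> distr M \<nu> (V n i) = \<nu>"
    and c_int: "\<And>n \<omega>. c_int n \<omega> = opt (imbalance n (\<lambda>i. U n i \<omega>) (\<lambda>i. V n i \<omega>))"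
    and optimal: "\<And>n. AE \<omega> in M. optimal_solution len v_minus v_plus
                    (imbalance n (\<lambda>i. U n i \<omega>) (\<lambda>i. V n i \<omega>)) (c_int n \<omega>)"
    and ties: "sign_neutral_ties len v_minus v_plus opt"
    and measurable_opt: "\<And>n e. (\<lambda>(u, v). opt (imbalance n u v) $ e) \<in>
           (\<Pi>\<^sub>M i\<in>{..<n}. \<mu>) \<Otimes>\<^sub>M (\<Pi>\<^sub>M i\<in>{..<n}. \<nu>) \<rightarrow>\<^sub>M count_space UNIV"
    and mu_eq_nu: "\<mu> = \<nu>"
  shows "\<forall>e.
      (\<forall>n\<ge>1. integrable M (\<lambda>\<omega>. real_of_int (c_int n \<omega> $ e)) \<and>
             (\<integral>\<omega>. real_of_int (c_int n \<omega> $ e) \<partial>M) = 0) \<and>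
      (\<forall>n\<ge>1. distr M (count_space UNIV) (\<lambda>\<omega>. c_int n \<omega> $ e) =
             distr M (count_space UNIV) (\<lambda>\<omega>. - (c_int n \<omega> $ e))) \<and>
      (\<exists>C>0. \<forall>n\<ge>1. \<forall>t\<ge>0.
             measure M {\<omega> \<in> space M. t \<le> \<bar>real_of_int (c_int n \<omega> $ e)\<bar>}
               \<le> 2 * exp (- (t\<^sup>2 / (C * real n))))"
proof -
  interpret network_measure len \<mu>
    by (intro network_measure.intro network_measure_axioms.intro mu len_nonneg segments)
  interpret M: prob_space M
    by (rule M)
  define X where "X n \<omega> = (\<lambda>j\<in>indices n. case_sum (U n) (V n) j \<omega>)" for n \<omega>
  have rv: "case_sum (U n) (V n) j \<in> M \<rightarrow>\<^sub>M \<mu>" if "j \<in> indices n" for n j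
  proof -
    have "case_sum (U n) (V n) j \<in> M \<rightarrow>\<^sub>M case_sum (\<lambda>_. \<mu>) (\<lambda>_. \<nu>) j"
      using indep[of n] that unfolding M.indep_vars_def indices_def by blast
    thus ?thesis
      using mu_eq_nu by (cases j) simp_all
  qed
  have X [measurable]: "X n \<in> M \<rightarrow>\<^sub>M samples n" for n
    unfolding X_def[abs_def] samples_def by (intro measurable_restrict rv)
  have distr_X: "distr M (samples n) (X n) = samples n" if "1 \<le> n" for n
  proof -
    have "case_sum (\<lambda>_. \<mu>) (\<lambda>_. \<nu>) = (\<lambda>_ :: nat + nat. \<mu>)"
      using mu_eq_nu by (auto simp: fun_eq_iff split: sum.split)
    hence "M.indep_vars (\<lambda>_. \<mu>) (case_sum (U n) (V n)) (indices n)"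
      using indep[of n] by (simp add: indices_def)
    \<comment> \<open>Characterising independence by the product law requires a nonempty index set;
      hence the restriction to positive \<open>n\<close>.\<close>
    moreover have "indices n \<noteq> {}"
      using that indices(2)[of 0 n] by force
    ultimately have "distr M (samples n) (X n) = (\<Pi>\<^sub>M j\<in>indices n. distr M \<mu> (case_sum (U n) (V n) j))"
      using rv unfolding samples_def X_def[abs_def] by (subst (asm) M.indep_vars_iff_distr_eq_PiM') auto
    also have "\<dots> = samples n"
      unfolding samples_def using distr_U distr_V mu_eq_nu by (intro PiM_cong) (auto simp: indices_def)
    finally show ?thesis .
  qed
  have profile_X: "profile n (X n \<omega>) = imbalance n (\<lambda>i. U n i \<omega>) (\<lambda>i. V n i \<omega>)" for n \<omega>
    unfolding profile_def by (rule imbalance_cong) (auto simp: X_def)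
  hence c_X: "c_int n \<omega> = opt (profile n (X n \<omega>))" for n \<omega>
    by (simp add: c_int)
  have meas [measurable]: "(\<lambda>y. opt (profile n y) $ e) \<in> samples n \<rightarrow>\<^sub>M count_space UNIV" for n e
  proof -
    \<comment> \<open>Measurability of \<open>opt\<close> is given on pairs of families, so the
      coordinates are regrouped into supply and demand.\<close>
    have "(\<lambda>y. (\<lambda>i\<in>{..<n}. y (Inl i), \<lambda>i\<in>{..<n}. y (Inr i))) \<in>
        samples n \<rightarrow>\<^sub>M (\<Pi>\<^sub>M i\<in>{..<n}. \<mu>) \<Otimes>\<^sub>M (\<Pi>\<^sub>M i\<in>{..<n}. \<nu>)"
      unfolding mu_eq_nu[symmetric] by (intro measurable_Pair measurable_restrict measurable_sample) auto
    from measurable_compose[OF this measurable_opt[of n e]]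
    have "(\<lambda>y. opt (imbalance n (\<lambda>i\<in>{..<n}. y (Inl i)) (\<lambda>i\<in>{..<n}. y (Inr i))) $ e) \<in> samples n \<rightarrow>\<^sub>M count_space UNIV"
      by simp
    moreover have "imbalance n (\<lambda>i\<in>{..<n}. y (Inl i)) (\<lambda>i\<in>{..<n}. y (Inr i)) = profile n y" for y
      unfolding profile_def by (rule imbalance_cong) auto
    ultimately show ?thesis
      by simp
  qed
  have c_meas [measurable]: "(\<lambda>\<omega>. c_int n \<omega> $ e) \<in> M \<rightarrow>\<^sub>M count_space UNIV" for n e
    unfolding c_X by measurable
  have pred_opt: "Measurable.pred (samples n) (\<lambda>y. optimal_solution len v_minus v_plus (profile n y) (opt (profile n y)))" for n
    using meas by (rule pred_optimal_choice)
  have optimal_samples: "AE y in samples n. optimal_solution len v_minus v_plus (profile n y) (opt (profile n y))"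
    if "1 \<le> n" for n
    using optimal[of n] pred_opt[of n]
    by (subst distr_X[OF that, symmetric], subst AE_distr_iff) (auto simp: c_X profile_X)
  have symmetric: "distr M (count_space UNIV) (\<lambda>\<omega>. c_int n \<omega> $ e) =
      distr M (count_space UNIV) (\<lambda>\<omega>. - (c_int n \<omega> $ e))" if "1 \<le> n" for n e
  proof -
    \<comment> \<open>Used for the identity and for negation, to compare both laws on the product
      space.\<close>
    have push: "distr M (count_space UNIV) (\<lambda>\<omega>. h (c_int n \<omega> $ e)) =
        distr (samples n) (count_space UNIV) (\<lambda>y. h (opt (profile n y) $ e))" for h :: "int \<Rightarrow> int"
    proof -
      have "distr (distr M (samples n) (X n)) (count_space UNIV) (\<lambda>y. h (opt (profile n y) $ e)) =
          distr M (count_space UNIV) (\<lambda>\<omega>. h (c_int n \<omega> $ e))"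
        by (subst distr_distr) (auto simp: c_X comp_def)
      thus ?thesis
        by (simp add: distr_X[OF that])
    qed
    have "distr (samples n) (count_space UNIV) (\<lambda>y. opt (profile n y) $ e) =
        distr (samples n) (count_space UNIV) (\<lambda>y. opt (profile n (swap n y)) $ e)"
      by (subst (1) distr_swap[symmetric], subst distr_distr) (auto simp: comp_def)
    also have "\<dots> = distr (samples n) (count_space UNIV) (\<lambda>y. - (opt (profile n y) $ e))"
      using sign_neutral_choice[OF ties meas optimal_samples[OF that]]
      by (intro distr_cong_AE) (auto elim!: eventually_mono)
    finally show ?thesis
      using push[of "\<lambda>k. k"] push[of uminus] by simp
  qed
  obtain \<alpha> where \<alpha>: "0 \<le> \<alpha>"
    "\<And>n y c e. optimal_solution len v_minus v_plus (profile n y) c \<Longrightarrow> \<bar>real_of_int (c $ e)\<bar> \<le> variation \<alpha> n y"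
    using optimal_solution_variation[OF no_zero_cycle] by metis
  have bound: "AE \<omega> in M. \<bar>real_of_int (c_int n \<omega> $ e)\<bar> \<le> variation \<alpha> n (X n \<omega>)" for n e
    using optimal[of n] by eventually_elim (auto intro!: \<alpha>(2) simp: profile_X)
  have integrable: "integrable M (\<lambda>\<omega>. real_of_int (c_int n \<omega> $ e))" for n e
  proof (rule M.integrable_const_bound)
    show "AE \<omega> in M. norm (real_of_int (c_int n \<omega> $ e)) \<le> n * mass \<alpha>"
      using bound[of n e] by eventually_elim (use variation_le[OF \<alpha>(1)] in \<open>auto intro: order.trans\<close>)
  qed simp
  have centered: "(\<integral>\<omega>. real_of_int (c_int n \<omega> $ e) \<partial>M) = 0" if "1 \<le> n" for n e
  proof -
    \<comment> \<open>The mean depends only on the law, so by symmetry it equals its own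
      negative.\<close>
    have "(\<integral>\<omega>. real_of_int (c_int n \<omega> $ e) \<partial>M) =
        (\<integral>k. real_of_int k \<partial>distr M (count_space UNIV) (\<lambda>\<omega>. c_int n \<omega> $ e))"
      by (subst integral_distr) auto
    also have "\<dots> = (\<integral>\<omega>. - real_of_int (c_int n \<omega> $ e) \<partial>M)"
      unfolding symmetric[OF that] by (subst integral_distr) auto
    finally show ?thesis
      by simp
  qed
  have tail: "measure M {\<omega> \<in> space M. t \<le> \<bar>real_of_int (c_int n \<omega> $ e)\<bar>}
      \<le> 2 * exp (- (t\<^sup>2 / (2 * (mass \<alpha>)\<^sup>2 * n)))" if "1 \<le> n" "0 \<le> t" for n t e
  proof -
    have "measure M {\<omega> \<in> space M. t \<le> \<bar>real_of_int (c_int n \<omega> $ e)\<bar>} \<le>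
        measure M {\<omega> \<in> space M. t \<le> variation \<alpha> n (X n \<omega>)}"
      using bound[of n e] by (intro M.finite_measure_mono_AE) (auto elim!: eventually_mono)
    also have "\<dots> = measure (distr M (samples n) (X n)) {y \<in> space (samples n). t \<le> variation \<alpha> n y}"
      by (subst measure_distr) (auto intro!: arg_cong[where f = "measure M"] dest: measurable_space[OF X])
    also have "\<dots> \<le> 2 * exp (- (t\<^sup>2 / (2 * (mass \<alpha>)\<^sup>2 * n)))"
      unfolding distr_X[OF that(1)] using that by (intro variation_tail \<alpha>) auto
    finally show ?thesis .
  qed
  \<comment> \<open>This is the constant \<open>C\<close>; it involves neither \<open>n\<close> nor
    \<open>t\<close>.\<close>
  have "0 < 2 * (mass \<alpha>)\<^sup>2"
    using mass_pos[OF \<alpha>(1)] by simp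
  thus ?thesis
    using integrable centered symmetric tail by blast
qed

end
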